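(* Let $\mathbf Y$ be a set with functions $\{d_Y\}_{Y\in\mathbf Y}$ satisfying the strong projection axioms (SP 1)-(SP 5) with projection constant $\theta\ge0$. For $K\ge3\theta$, the projection complex $\mathcal P_K(\mathbf Y)$ is a quasi-tree.
   Context: For each $Y\in\mathbf Y$, $d_Y:(\mathbf Y\setminus\{Y\})^2\to[0,\infty]$ is a function. Strong projection axioms with constant $\theta$: (SP 1) $d_Y(X,Z)=d_Y(Z,X)$; (SP 2) $d_Y(X,Z)+d_Y(Z,W)\ge d_Y(X,W)$; (SP 3) if $d_Y(X,Z)>\theta$ then $d_Z(X,W)=d_Z(Y,W)$ for all $W\in\mathbf Y\setminus\{Z\}$; (SP 4) $d_Y(X,X)\le\theta$; (SP 5) $\{Y\in\mathbf Y\setminus\{X,Z\}: d_Y(X,Z)>\theta\}$ is finite for all $X,Z\in\mathbf Y$. $\mathbf Y_K(X,Z)$ is the set of $Y\in\mathbf Y\setminus\{X,Z\}$ with $d_Y(X,Z)>K$. $\mathcal P_K(\mathbf Y)$ is the graph with vertex set $\mathbf Y$ and an edge (of length one) between two distinct vertices $X,Z$ exactly when $\mathbf Y_K(X,Z)=\emptyset$. A quasi-tree is a connected graph that is quasi-isometric to a tree. *)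

theory Defs
  imports "HOL-Library.Extended_Nonnegative_Real"
begin

section \<open>Simple graphs and trees\<close>

text \<open>A graph is a vertex set together with a set of two-element sets of vertices. Vertex sets
  may be infinite.\<close>

definition simple_graph :: "'a set \<Rightarrow> 'a set set \<Rightarrow> bool" where
  "simple_graph V E \<longleftrightarrow> (\<forall>e\<in>E. \<exists>u\<in>V. \<exists>v\<in>V. u \<noteq> v \<and> e = {u, v})"

definition walk :: "'a set \<Rightarrow> 'a set set \<Rightarrow> 'a list \<Rightarrow> bool" where
  "walk V E xs \<longleftrightarrow> xs \<noteq> [] \<and> set xs \<subseteq> V \<and> successively (\<lambda>u v. {u, v} \<in> E) xs"

definition walk_betw :: "'a set \<Rightarrow> 'a set set \<Rightarrow> 'a \<Rightarrow> 'a list \<Rightarrow> 'a \<Rightarrow> bool" where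
  "walk_betw V E x xs y \<longleftrightarrow> walk V E xs \<and> hd xs = x \<and> last xs = y"

text \<open>The empty graph counts as connected, and hence as a tree. A nonempty graph is never
  quasi-isometric to it.\<close>

definition connected_graph :: "'a set \<Rightarrow> 'a set set \<Rightarrow> bool" where
  "connected_graph V E \<longleftrightarrow> (\<forall>x\<in>V. \<forall>y\<in>V. \<exists>xs. walk_betw V E x xs y)"

definition cycle :: "'a set \<Rightarrow> 'a set set \<Rightarrow> 'a list \<Rightarrow> bool" where
  "cycle V E xs \<longleftrightarrow>
     walk V E xs \<and> distinct xs \<and> 3 \<le> length xs \<and> {last xs, hd xs} \<in> E"

definition tree_graph :: "'a set \<Rightarrow> 'a set set \<Rightarrow> bool" where
  "tree_graph V E \<longleftrightarrow>
     simple_graph V E \<and> connected_graph V E \<and> (\<nexists>xs. cycle V E xs)"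

text \<open>The path metric with edges of length one, restricted to the vertices. The vertex set is
  1-dense in the geometric realization, so it carries the same large-scale geometry. The value
  is meaningful only if \<open>x\<close> and \<open>y\<close> are joined by a walk.\<close>

definition graph_dist :: "'a set \<Rightarrow> 'a set set \<Rightarrow> 'a \<Rightarrow> 'a \<Rightarrow> real" where
  "graph_dist V E x y =
     real (LEAST n. \<exists>xs. walk_betw V E x xs y \<and> length xs = Suc n)"


section \<open>Quasi-isometries and quasi-trees\<close>

definition quasi_isometry ::
    "'a set \<Rightarrow> ('a \<Rightarrow> 'a \<Rightarrow> real) \<Rightarrow> 'b set \<Rightarrow> ('b \<Rightarrow> 'b \<Rightarrow> real) \<Rightarrow> ('a \<Rightarrow> 'b) \<Rightarrow> bool" where
  "quasi_isometry M d N e f \<longleftrightarrow>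
     f ` M \<subseteq> N \<and>
     (\<exists>L C. 1 \<le> L \<and> 0 \<le> C \<and>
        (\<forall>x\<in>M. \<forall>y\<in>M. d x y / L - C \<le> e (f x) (f y) \<and> e (f x) (f y) \<le> L * d x y + C) \<and>
        (\<forall>z\<in>N. \<exists>x\<in>M. e (f x) z \<le> C))"

text \<open>The vertices of the tree are taken from the vertex type of the graph. This loses no
  generality. If \<open>V\<close> is finite, it is bounded and a one-vertex tree does. If \<open>V\<close> is infinite,
  any tree quasi-isometric to it can be replaced by the subtree spanned by the image of \<open>V\<close>,
  whose vertex set has cardinality at most that of \<open>V\<close>.\<close>

definition quasi_tree :: "'a set \<Rightarrow> 'a set set \<Rightarrow> bool" where
  "quasi_tree V E \<longleftrightarrow>
     simple_graph V E \<and> connected_graph V E \<and>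
     (\<exists>(W :: 'a set) F f. tree_graph W F \<and>
        quasi_isometry V (graph_dist V E) W (graph_dist W F) f)"


section \<open>Strong projection axioms and the projection complex\<close>

text \<open>The term \<open>d Y X Z\<close> stands for $d_Y(X,Z)$. It is used only for \<open>X\<close> and \<open>Z\<close> different
  from \<open>Y\<close>. In \<open>SP3\<close> the restriction \<open>X \<noteq> Z\<close>, needed for \<open>d Z X W\<close> to make sense, follows from
  the premise and \<open>SP4\<close>.\<close>

locale strong_projection_axioms =
  fixes YY :: "'a set" and d :: "'a \<Rightarrow> 'a \<Rightarrow> 'a \<Rightarrow> ennreal" and \<theta> :: real
  assumes SP1: "\<lbrakk>Y \<in> YY; X \<in> YY - {Y}; Z \<in> YY - {Y}\<rbrakk> \<Longrightarrow> d Y X Z = d Y Z X"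
    and SP2: "\<lbrakk>Y \<in> YY; X \<in> YY - {Y}; Z \<in> YY - {Y}; W \<in> YY - {Y}\<rbrakk>
      \<Longrightarrow> d Y X Z + d Y Z W \<ge> d Y X W"
    and SP3: "\<lbrakk>Y \<in> YY; Z \<in> YY - {Y}; X \<in> YY - {Y, Z}; d Y X Z > ennreal \<theta>; W \<in> YY - {Z}\<rbrakk>
      \<Longrightarrow> d Z X W = d Z Y W"
    and SP4: "\<lbrakk>Y \<in> YY; X \<in> YY - {Y}\<rbrakk> \<Longrightarrow> d Y X X \<le> ennreal \<theta>"
    and SP5: "\<lbrakk>X \<in> YY; Z \<in> YY\<rbrakk> \<Longrightarrow> finite {Y \<in> YY - {X, Z}. d Y X Z > ennreal \<theta>}"

definition big_projections ::
    "'a set \<Rightarrow> ('a \<Rightarrow> 'a \<Rightarrow> 'a \<Rightarrow> ennreal) \<Rightarrow> real \<Rightarrow> 'a \<Rightarrow> 'a \<Rightarrow> 'a set" where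
  "big_projections YY d K X Z = {Y \<in> YY - {X, Z}. d Y X Z > ennreal K}"

definition projection_complex_edges ::
    "'a set \<Rightarrow> ('a \<Rightarrow> 'a \<Rightarrow> 'a \<Rightarrow> ennreal) \<Rightarrow> real \<Rightarrow> 'a set set" where
  "projection_complex_edges YY d K =
     {{X, Z} | X Z. X \<in> YY \<and> Z \<in> YY \<and> X \<noteq> Z \<and> big_projections YY d K X Z = {}}"

end

theory Submission
  imports Defs
begin

text \<open>
  Any two vertices $X, Z$ are joined by a path whose inner vertices lie in $Y_K(X,Z)$, and
  conversely every walk from $X$ to $Z$ passes within distance $2$ of each
  $Y \in Y_K(X,Z)$: away from $Y$, adjacent vertices have the same projection to $Y$.
  Consequently two vertices at the same distance $n$ from a base vertex which can be joined
  outside the ball of radius $n - 1$ are within distance $13$ of each other. This uniform bound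
  on level components replaces Manning's bottleneck criterion: the level components, each
  attached to the component of the next lower level that it borders, form a tree, and sending a
  vertex to its component is a quasi-isometry.
\<close>

section \<open>Walks of given length\<close>

text \<open>Keeping the vertex set \<open>S\<close> apart from \<open>E\<close> allows walks
  confined to the complement of a ball, or to a prescribed set of vertices, over one fixed edge
  set.\<close>

inductive steps :: "'a set \<Rightarrow> 'a set set \<Rightarrow> nat \<Rightarrow> 'a \<Rightarrow> 'a \<Rightarrow> bool" for S E where
  steps_refl: "x \<in> S \<Longrightarrow> steps S E 0 x x"
| steps_Suc: "\<lbrakk>x \<in> S; {x, y} \<in> E; steps S E n y z\<rbrakk> \<Longrightarrow> steps S E (Suc n) x z"

lemma steps_in: "steps S E n x y \<Longrightarrow> x \<in> S \<and> y \<in> S"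
  by (induction rule: steps.induct) auto

lemma steps_trans:
  "\<lbrakk>steps S E m x y; steps S E n y z\<rbrakk> \<Longrightarrow> steps S E (m + n) x z"
  by (induction rule: steps.induct) (auto intro: steps.intros)

lemma steps_edge: "\<lbrakk>x \<in> S; y \<in> S; {x, y} \<in> E\<rbrakk> \<Longrightarrow> steps S E 1 x y"
  by (simp add: steps.intros)

lemma steps_sym: "steps S E n x y \<Longrightarrow> steps S E n y x"
proof (induction rule: steps.induct)
  case (steps_Suc x y n z)
  then have "steps S E 1 y x"
    using steps_in[of S E n y z] steps_edge[of y S x E] by (simp add: insert_commute)
  with steps_Suc.IH show ?case
    using steps_trans by fastforce
qed (rule steps_refl)

lemma steps_mono: "\<lbrakk>steps S E n x y; S \<subseteq> T\<rbrakk> \<Longrightarrow> steps T E n x y"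
  by (induction rule: steps.induct) (auto intro: steps.intros)

text \<open>A discrete connectedness argument: the first step that leaves \<open>P\<close> ends in
  \<open>Q\<close>, because \<open>P\<close> and \<open>Q\<close> cover \<open>S\<close>; if no step
  leaves \<open>P\<close>, the endpoint satisfies both.\<close>

lemma steps_crossing:
  assumes "steps S E n x y" and "P x" and "Q y" and "\<And>z. z \<in> S \<Longrightarrow> P z \<or> Q z"
  shows "(\<exists>z\<in>S. P z \<and> Q z) \<or> (\<exists>u\<in>S. \<exists>v\<in>S. {u, v} \<in> E \<and> P u \<and> Q v)"
  using assms
proof (induction rule: steps.induct)
  case (steps_Suc x y n z)
  then show ?case
    using steps_in by metis
qed auto

lemma walk_betw_imp_steps:
  "walk_betw S E x xs y \<Longrightarrow> steps S E (length xs - 1) x y"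
proof (induction xs arbitrary: x)
  case Nil
  then show ?case by (simp add: walk_betw_def walk_def)
next
  case (Cons a xs)
  show ?case
  proof (cases xs)
    case Nil
    with Cons.prems show ?thesis
      by (auto simp: walk_betw_def walk_def intro: steps_refl)
  next
    case (Cons b ys)
    with Cons.prems have "walk_betw S E b xs y" "a = x" "x \<in> S" "{x, b} \<in> E"
      by (auto simp: walk_betw_def walk_def)
    with Cons.IH Cons show ?thesis
      by (auto intro: steps_Suc)
  qed
qed

lemma steps_imp_walk_betw:
  "steps S E n x y \<Longrightarrow> \<exists>xs. walk_betw S E x xs y \<and> length xs = Suc n"
proof (induction rule: steps.induct)
  case (steps_refl x)
  then show ?case
    by (intro exI[of _ "[x]"]) (simp add: walk_betw_def walk_def)
next
  case (steps_Suc x y n z)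
  then obtain xs where xs: "walk_betw S E y xs z" "length xs = Suc n"
    by blast
  with steps_Suc.hyps show ?case
    by (intro exI[of _ "x # xs"]) (auto simp: walk_betw_def walk_def successively_Cons)
qed

lemma steps_iff_walk_betw:
  "steps S E n x y \<longleftrightarrow> (\<exists>xs. walk_betw S E x xs y \<and> length xs = Suc n)"
  using walk_betw_imp_steps steps_imp_walk_betw by fastforce

lemma connected_graph_iff_steps:
  "connected_graph V E \<longleftrightarrow> (\<forall>x\<in>V. \<forall>y\<in>V. \<exists>n. steps V E n x y)"
  unfolding connected_graph_def
  using walk_betw_imp_steps steps_imp_walk_betw by metis

section \<open>The path metric on vertices\<close>

definition hops :: "'a set \<Rightarrow> 'a set set \<Rightarrow> 'a \<Rightarrow> 'a \<Rightarrow> nat" where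
  "hops V E x y = (LEAST n. steps V E n x y)"

lemma graph_dist_eq_hops: "graph_dist V E x y = real (hops V E x y)"
  by (simp add: graph_dist_def hops_def steps_iff_walk_betw)

lemma hops_le: "steps V E n x y \<Longrightarrow> hops V E x y \<le> n"
  by (simp add: hops_def Least_le)

lemma hops_edge: "\<lbrakk>x \<in> V; y \<in> V; {x, y} \<in> E\<rbrakk> \<Longrightarrow> hops V E x y \<le> 1"
  by (blast intro: hops_le steps_edge)

lemma hops_refl: "x \<in> V \<Longrightarrow> hops V E x x = 0"
  using hops_le steps_refl by fastforce

lemma hops_sym: "hops V E x y = hops V E y x"
proof -
  have "steps V E n x y \<longleftrightarrow> steps V E n y x" for n
    by (rule iffI; erule steps_sym)
  then show ?thesis
    by (simp add: hops_def)
qed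

locale connected_simple_graph =
  fixes V :: "'a set" and E :: "'a set set"
  assumes simple: "simple_graph V E" and connected: "connected_graph V E"
begin

lemma edge_in: "{x, y} \<in> E \<Longrightarrow> x \<in> V \<and> y \<in> V"
  using simple by (auto simp: simple_graph_def doubleton_eq_iff)

lemma steps_hops: "\<lbrakk>x \<in> V; y \<in> V\<rbrakk> \<Longrightarrow> steps V E (hops V E x y) x y"
  using connected unfolding connected_graph_iff_steps hops_def by (metis LeastI)

lemma hops_triangle:
  "\<lbrakk>x \<in> V; y \<in> V; z \<in> V\<rbrakk> \<Longrightarrow> hops V E x z \<le> hops V E x y + hops V E y z"
  by (rule hops_le[OF steps_trans[OF steps_hops steps_hops]])

lemma hops_eq_0: "\<lbrakk>x \<in> V; y \<in> V; hops V E x y = 0\<rbrakk> \<Longrightarrow> x = y"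
  using steps_hops[of x y] by (auto elim: steps.cases)

lemma hops_edge_le: "\<lbrakk>r \<in> V; {x, y} \<in> E\<rbrakk> \<Longrightarrow> hops V E r y \<le> Suc (hops V E r x)"
  using hops_triangle[of r x y] hops_edge[of x V y E] edge_in[of x y] by auto

lemma exists_closer_neighbour:
  assumes "r \<in> V" "x \<in> V" "x \<noteq> r"
  shows "\<exists>y. {x, y} \<in> E \<and> hops V E r x = Suc (hops V E r y)"
proof -
  have "steps V E (hops V E r x) x r"
    by (rule steps_sym[OF steps_hops[OF assms(1,2)]])
  then show ?thesis
  proof cases
    case (steps_Suc y n)
    then have "hops V E r y \<le> n"
      using hops_le hops_sym by metis
    moreover have "hops V E r x \<le> Suc (hops V E r y)"
      using hops_edge_le[of r y x] steps_Suc assms by (simp add: insert_commute)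
    ultimately show ?thesis
      using steps_Suc by auto
  qed (use assms in auto)
qed

text \<open>Each edge of a shortest walk lowers the distance to \<open>r\<close> by exactly one, so
  the triangle inequality is an equality at every vertex passed.\<close>

lemma geodesic:
  assumes "x \<in> V" "r \<in> V"
  shows "steps {z \<in> V. hops V E x z + hops V E z r = hops V E x r} E (hops V E x r) x r"
proof -
  \<comment> \<open>The start \<open>y\<close> varies while \<open>x\<close> stays fixed: the rest
    of a shortest walk is again a shortest walk, starting on a geodesic from \<open>x\<close> to
    \<open>r\<close>.\<close>
  have "steps {z \<in> V. hops V E x z + hops V E z r = hops V E x r} E n y r"
    if "steps V E n y r" "y \<in> V" "n = hops V E y r" "hops V E x y + hops V E y r = hops V E x r"
    for n y
    using that
  proof (induction rule: steps.induct)
    case (steps_refl y)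
    then show ?case by (auto intro: steps.steps_refl)
  next
    case (steps_Suc y z n w)
    have z: "z \<in> V"
      using steps_Suc edge_in by blast
    have w: "w \<in> V"
      using steps_in[OF steps_Suc.hyps(3)] by blast
    have "hops V E z w \<le> n"
      by (rule hops_le[OF steps_Suc.hyps(3)])
    moreover have "hops V E y w \<le> hops V E y z + hops V E z w"
      by (intro hops_triangle) (use steps_Suc z w in auto)
    moreover have "hops V E y z \<le> 1"
      using steps_Suc z by (intro hops_edge) auto
    ultimately have 1: "n = hops V E z w" "hops V E y z = 1"
      using steps_Suc.prems by auto
    have "hops V E x w \<le> hops V E x z + hops V E z w"
      by (intro hops_triangle) (use z w assms in auto)
    moreover have "hops V E x z \<le> hops V E x y + hops V E y z"
      by (intro hops_triangle) (use steps_Suc z w assms in auto)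
    ultimately have "hops V E x z + hops V E z w = hops V E x w"
      using 1 steps_Suc.prems by auto
    with 1 z have "steps {z \<in> V. hops V E x z + hops V E z w = hops V E x w} E n z w"
      by (intro steps_Suc.IH)
    with steps_Suc.hyps(2) steps_Suc.prems show ?case
      by (intro steps.steps_Suc[of y _ z]) auto
  qed
  then show ?thesis
    using steps_hops[OF assms] assms by (simp add: hops_refl)
qed

end


section \<open>Trees given by a parent map\<close>

locale parent_map =
  fixes W :: "'a set" and root :: 'a and p :: "'a \<Rightarrow> 'a" and lev :: "'a \<Rightarrow> nat"
  assumes root_in: "root \<in> W"
    and p_in: "w \<in> W \<Longrightarrow> p w \<in> W"
    and p_root: "p root = root"
    and lev_less: "\<lbrakk>w \<in> W; w \<noteq> root\<rbrakk> \<Longrightarrow> lev (p w) < lev w"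
begin

text \<open>The root is left out because \<open>p root = root\<close> would give a loop.\<close>

definition edges :: "'a set set" where
  "edges = {{w, p w} | w. w \<in> W - {root}}"

lemma edge_cases: "{u, v} \<in> edges \<Longrightarrow>
    v = p u \<and> u \<in> W \<and> lev v < lev u \<or> u = p v \<and> v \<in> W \<and> lev u < lev v"
  using lev_less by (auto simp: edges_def doubleton_eq_iff)

lemma steps_parent:
  assumes "w \<in> W"
  shows "\<exists>n\<le>1. steps W edges n w (p w)"
proof (cases "w = root")
  case True
  then show ?thesis
    using steps_refl[OF root_in] p_root by auto
next
  case False
  with assms have "{w, p w} \<in> edges"
    by (auto simp: edges_def)
  then show ?thesis
    using steps_edge[OF assms p_in[OF assms]] by blast
qed

lemma steps_root: "w \<in> W \<Longrightarrow> \<exists>n. steps W edges n w root"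
proof (induction "lev w" arbitrary: w rule: less_induct)
  case less
  show ?case
  proof (cases "w = root")
    case True
    then show ?thesis
      using steps_refl[OF root_in] by blast
  next
    case False
    then obtain n where "steps W edges n (p w) root"
      using less lev_less p_in by blast
    moreover obtain m where "steps W edges m w (p w)"
      using steps_parent less.prems by blast
    ultimately show ?thesis
      by (blast intro: steps_trans)
  qed
qed

text \<open>In a cycle, both neighbours of a vertex of maximal level would be its parent.\<close>

lemma no_cycle: "\<not> cycle W edges xs"
proof
  assume c: "cycle W edges xs"
  define n where "n = length xs"
  have n: "3 \<le> n" and dist: "distinct xs"
    using c by (auto simp: cycle_def n_def)
  have adj: "{xs ! i, xs ! (Suc i mod n)} \<in> edges" if "i < n" for i
  proof (cases "Suc i < n")
    case True
    then show ?thesis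
      using c by (auto simp: cycle_def walk_def n_def successively_conv_nth)
  next
    case False
    then have "i = n - 1"
      using that by simp
    then show ?thesis
      using c n False by (auto simp: cycle_def walk_def n_def last_conv_nth hd_conv_nth)
  qed
  have "lev ` set xs \<noteq> {}"
    using n by (auto simp: n_def)
  then have "Max (lev ` set xs) \<in> lev ` set xs"
    by (intro Max_in) auto
  then obtain w where "w \<in> set xs" "lev w = Max (lev ` set xs)"
    by force
  then have w: "w \<in> set xs" "\<And>u. u \<in> set xs \<Longrightarrow> lev u \<le> lev w"
    by auto
  then obtain i where i: "i < n" "w = xs ! i"
    by (auto simp: in_set_conv_nth n_def)
  \<comment> \<open>\<open>j\<close> and \<open>k\<close> are the two cyclic neighbours of
    \<open>i\<close>; they differ because the cycle has at least three vertices.\<close>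
  define j where "j = (if i = 0 then n - 1 else i - 1)"
  have j: "j < n" "Suc j mod n = i"
    using i n by (auto simp: j_def)
  define k where "k = Suc i mod n"
  have k: "k < n" "j \<noteq> k"
    using i n by (auto simp: k_def j_def mod_Suc)
  have "xs ! j = p w" "xs ! k = p w"
    using adj[OF j(1)] adj[OF i(1)] w(2)[of "xs ! j"] w(2)[of "xs ! k"] j k i
    by (auto dest!: edge_cases simp: n_def k_def)
  with dist j k show False
    using nth_eq_iff_index_eq[OF dist, of j k] by (simp add: n_def)
qed

lemma tree: "tree_graph W edges"
  unfolding tree_graph_def
proof (intro conjI)
  show "simple_graph W edges"
    unfolding simple_graph_def edges_def using p_in lev_less by fastforce
  show "connected_graph W edges"
    unfolding connected_graph_iff_steps
    using steps_root by (blast intro: steps_sym steps_trans)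
  show "\<nexists>xs. cycle W edges xs"
    using no_cycle by blast
qed

text \<open>An edge goes to a parent or to a child. Prepending it either lengthens one of the two
  ascents by one or cancels a step.\<close>

lemma common_ancestor:
  "steps W edges n u v \<Longrightarrow> \<exists>i j. i + j \<le> n \<and> (p ^^ i) u = (p ^^ j) v"
proof (induction rule: steps.induct)
  case (steps_refl x)
  then show ?case by (intro exI[of _ 0]) simp
next
  case (steps_Suc x y n z)
  then obtain i j where ij: "i + j \<le> n" "(p ^^ i) y = (p ^^ j) z"
    by blast
  from edge_cases[OF steps_Suc.hyps(2)] consider "y = p x" | "x = p y"
    by blast
  then show ?case
  proof cases
    case 1
    with ij show ?thesis
      by (intro exI[of _ "Suc i"] exI[of _ j]) (simp add: funpow_swap1)
  next
    case 2
    show ?thesis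
    proof (cases i)
      case 0
      with 2 ij show ?thesis
        by (intro exI[of _ 0] exI[of _ "Suc j"]) simp
    next
      case (Suc k)
      with 2 ij show ?thesis
        by (intro exI[of _ k] exI[of _ j]) (simp add: funpow_swap1)
    qed
  qed
qed

end


section \<open>The tree of components of complements of balls\<close>

locale bottleneck_graph = connected_simple_graph +
  fixes r :: 'a and D :: nat
  assumes r: "r \<in> V"
    and bottleneck: "\<lbrakk>x \<in> V; y \<in> V; hops V E r x = hops V E r y;
      steps {z \<in> V. hops V E r x \<le> hops V E r z} E n x y\<rbrakk> \<Longrightarrow> hops V E x y \<le> D"
begin

abbreviation level :: "'a \<Rightarrow> nat" where
  "level x \<equiv> hops V E r x"

text \<open>The tree is realised on representatives of the level components, chosen among the vertices
  of the graph.\<close>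

definition same_comp :: "'a \<Rightarrow> 'a \<Rightarrow> bool" where
  "same_comp x y \<longleftrightarrow> level x = level y \<and> (\<exists>n. steps {z \<in> V. level x \<le> level z} E n x y)"

lemma same_comp_in: "same_comp x y \<Longrightarrow> x \<in> V \<and> y \<in> V"
  by (auto simp: same_comp_def dest: steps_in)

lemma same_comp_refl: "x \<in> V \<Longrightarrow> same_comp x x"
  by (auto simp: same_comp_def intro!: exI[of _ 0] steps_refl)

lemma same_comp_sym: "same_comp x y \<Longrightarrow> same_comp y x"
  unfolding same_comp_def by (elim conjE exE, intro conjI exI) (simp, simp, erule steps_sym)

lemma same_comp_trans:
  assumes "same_comp x y" "same_comp y z"
  shows "same_comp x z"
proof -
  obtain m n where "steps {w \<in> V. level x \<le> level w} E m x y"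
    "steps {w \<in> V. level x \<le> level w} E n y z" "level x = level z"
    using assms by (auto simp: same_comp_def)
  then show ?thesis
    unfolding same_comp_def by (blast intro: steps_trans)
qed

lemma same_comp_hops: "same_comp x y \<Longrightarrow> hops V E x y \<le> D"
  using bottleneck same_comp_in by (metis (no_types, lifting) same_comp_def)

section \<open>Representatives and parents of level components\<close>

definition rep :: "'a \<Rightarrow> 'a" where
  "rep x = (SOME y. same_comp x y)"

lemma same_comp_rep: "x \<in> V \<Longrightarrow> same_comp x (rep x)"
  unfolding rep_def by (rule someI) (rule same_comp_refl)

lemma rep_in: "x \<in> V \<Longrightarrow> rep x \<in> V"
  using same_comp_rep same_comp_in by blast

text \<open>Equivalent vertices define the same predicate \<open>same_comp x\<close>, so the choice
  operator picks the same element.\<close>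

lemma rep_eq_iff: "\<lbrakk>x \<in> V; y \<in> V\<rbrakk> \<Longrightarrow> rep x = rep y \<longleftrightarrow> same_comp x y"
proof
  assume "same_comp x y"
  then have "same_comp x = same_comp y"
    using same_comp_sym same_comp_trans by blast
  then show "rep x = rep y"
    by (simp add: rep_def)
qed (metis same_comp_rep same_comp_sym same_comp_trans)

definition par :: "'a \<Rightarrow> 'a" where
  "par x = (if x = r then r else SOME y. {x, y} \<in> E \<and> level x = Suc (level y))"

lemma par:
  assumes "x \<in> V" "x \<noteq> r"
  shows "{x, par x} \<in> E" "level x = Suc (level (par x))"
  using someI_ex[OF exists_closer_neighbour[OF r assms]] assms by (auto simp: par_def)

lemma par_in: "x \<in> V \<Longrightarrow> par x \<in> V"
  using par edge_in r by (metis par_def)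

lemma hops_par:
  assumes "x \<in> V"
  shows "hops V E x (par x) \<le> 1"
proof (cases "x = r")
  case True
  then show ?thesis
    using assms by (simp add: par_def hops_refl)
next
  case False
  then show ?thesis
    by (intro hops_edge assms par_in par(1))
qed

lemma par_funpow:
  assumes "x \<in> V"
  shows "(par ^^ i) x \<in> V \<and> hops V E x ((par ^^ i) x) \<le> i"
proof (induction i)
  case 0
  show ?case
    using assms by (simp add: hops_refl)
next
  case (Suc i)
  then show ?case
    using assms par_in hops_par[of "(par ^^ i) x"] hops_triangle[of x "(par ^^ i) x" "(par ^^ Suc i) x"]
    by fastforce
qed

text \<open>Makes the parent of a component well defined: the walk joining \<open>x\<close> and
  \<open>y\<close> stays above the lower level, so it can be extended by the two descending
  edges.\<close>

lemma same_comp_below: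
  assumes "same_comp x y" "{x, x'} \<in> E" "{y, y'} \<in> E" "level x = Suc (level x')" "level y = Suc (level y')"
  shows "same_comp x' y'"
proof -
  let ?S = "{z \<in> V. level x' \<le> level z}"
  obtain n where n: "steps {z \<in> V. level x \<le> level z} E n x y" and l: "level x = level y"
    using assms by (auto simp: same_comp_def)
  have V: "x \<in> V" "y \<in> V" "x' \<in> V" "y' \<in> V"
    using assms edge_in by blast+
  have "steps ?S E n x y"
    by (rule steps_mono[OF n]) (use assms in auto)
  moreover have "steps ?S E 1 x' x" "steps ?S E 1 y y'"
    by (rule steps_edge; use V assms l in \<open>simp add: insert_commute\<close>)+
  ultimately have "steps ?S E (1 + n + 1) x' y'"
    by (intro steps_trans)
  then show ?thesis
    using assms l by (auto simp: same_comp_def)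
qed

definition p :: "'a \<Rightarrow> 'a" where
  "p w = rep (par w)"

lemma level_rep: "x \<in> V \<Longrightarrow> level (rep x) = level x"
  using same_comp_rep by (simp add: same_comp_def)

lemma rep_root: "rep r = r"
  using level_rep[OF r] hops_eq_0[of r "rep r"] rep_in[OF r] r by (simp add: hops_refl)

text \<open>The map \<open>rep\<close> intertwines \<open>par\<close> with \<open>p\<close>, so
  ascents in the tree lift to ascents in the graph.\<close>

lemma p_rep:
  assumes "x \<in> V"
  shows "p (rep x) = rep (par x)"
proof (cases "x = r")
  case True
  then show ?thesis
    by (simp add: p_def rep_root)
next
  case False
  then have "rep x \<noteq> r"
    using par(2)[OF assms] level_rep[OF assms] r by (auto simp: hops_refl)
  then have "same_comp (par (rep x)) (par x)"
    using same_comp_below[OF same_comp_sym[OF same_comp_rep[OF assms]]]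
      par[OF rep_in[OF assms]] par[OF assms False] by blast
  then show ?thesis
    using assms par_in rep_in by (simp add: p_def rep_eq_iff)
qed

lemma p_funpow_rep: "x \<in> V \<Longrightarrow> (p ^^ i) (rep x) = rep ((par ^^ i) x)"
  by (induction i) (auto simp: p_rep par_funpow)

sublocale T: parent_map "rep ` V" r p level
proof
  show "r \<in> rep ` V"
    using r rep_root by force
  show "p r = r"
    by (simp add: p_def par_def rep_root)
  show "p w \<in> rep ` V" if "w \<in> rep ` V" for w
    using that par_in rep_in by (auto simp: p_def)
  show "level (p w) < level w" if "w \<in> rep ` V" "w \<noteq> r" for w
  proof -
    have "w \<in> V"
      using that rep_in by auto
    then show ?thesis
      using that par[of w] par_in by (simp add: p_def level_rep)
  qed
qed

text \<open>Levels of adjacent vertices differ by at most one. At equal levels the edge itself joins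
  them within one component; otherwise the lower component is the parent of the upper one.\<close>

lemma rep_edge:
  assumes "{x, y} \<in> E"
  shows "\<exists>n\<le>1. steps (rep ` V) T.edges n (rep x) (rep y)"
proof -
  have up: "\<exists>n\<le>1. steps (rep ` V) T.edges n (rep b) (rep a)"
    if e: "{a, b} \<in> E" and l: "level b = Suc (level a)" for a b
  proof -
    have V: "a \<in> V" "b \<in> V" "b \<noteq> r"
      using e l edge_in r by (auto simp: hops_refl)
    have "same_comp (par b) a"
      by (rule same_comp_below[of b b])
        (use V par same_comp_refl e l in \<open>auto simp: insert_commute\<close>)
    then have "p (rep b) = rep a"
      using V p_rep par_in by (simp add: rep_eq_iff)
    then show ?thesis
      using T.steps_parent[of "rep b"] V by auto
  qed
  have V: "x \<in> V" "y \<in> V"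
    using assms edge_in by blast+
  have e': "{y, x} \<in> E"
    using assms by (simp add: insert_commute)
  have "level y \<le> Suc (level x)" "level x \<le> Suc (level y)"
    using hops_edge_le r assms e' by blast+
  then consider "level y = Suc (level x)" | "level x = Suc (level y)" | "level x = level y"
    by linarith
  then show ?thesis
  proof cases
    case 1
    then show ?thesis
      using up[OF assms] by (blast intro: steps_sym)
  next
    case 2
    then show ?thesis
      using up[OF e'] by blast
  next
    case 3
    then have "same_comp x y"
      unfolding same_comp_def
      using V assms steps_edge[of x "{z \<in> V. level x \<le> level z}" y E] by auto
    then have "rep x = rep y"
      using V rep_eq_iff by blast
    then show ?thesis
      using V by (auto intro!: exI[of _ 0] steps_refl)
  qed
qed

lemma rep_lipschitz:
  "steps V E n x y \<Longrightarrow> \<exists>m\<le>n. steps (rep ` V) T.edges m (rep x) (rep y)"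
proof (induction rule: steps.induct)
  case (steps_refl x)
  then show ?case by (auto intro!: steps.steps_refl)
next
  case (steps_Suc x y n z)
  then obtain m k where "m \<le> n" "steps (rep ` V) T.edges m (rep y) (rep z)"
    "k \<le> 1" "steps (rep ` V) T.edges k (rep x) (rep y)"
    using rep_edge by blast
  then show ?case
    by (intro exI[of _ "k + m"]) (auto intro: steps_trans)
qed

text \<open>A tree walk yields a common ancestor after \<open>i\<close> and \<open>j\<close>
  ascents. Lifting these by \<open>par\<close> gives two vertices of one component, at distance at
  most \<open>D\<close>.\<close>

lemma rep_expanding:
  assumes "x \<in> V" "y \<in> V" "steps (rep ` V) T.edges n (rep x) (rep y)"
  shows "hops V E x y \<le> n + D"
proof -
  obtain i j where ij: "i + j \<le> n" "(p ^^ i) (rep x) = (p ^^ j) (rep y)"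
    using T.common_ancestor assms(3) by blast
  let ?x = "(par ^^ i) x" and ?y = "(par ^^ j) y"
  have x: "?x \<in> V" "hops V E x ?x \<le> i" and y: "?y \<in> V" "hops V E y ?y \<le> j"
    using assms par_funpow by blast+
  have "hops V E ?x ?y \<le> D"
    using ij x y assms by (simp add: p_funpow_rep rep_eq_iff same_comp_hops)
  moreover have "hops V E x y \<le> hops V E x ?x + hops V E ?x y"
    "hops V E ?x y \<le> hops V E ?x ?y + hops V E ?y y"
    using x y assms by (auto intro: hops_triangle)
  ultimately show ?thesis
    using x y ij hops_sym[of V E y ?y] by linarith
qed

lemma quasi_tree: "quasi_tree V E"
proof -
  let ?T = "rep ` V"
  have low: "hops V E x y \<le> hops ?T T.edges (rep x) (rep y) + D"
    and up: "hops ?T T.edges (rep x) (rep y) \<le> hops V E x y"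
    if xy: "x \<in> V" "y \<in> V" for x y
  proof -
    obtain m where m: "m \<le> hops V E x y" "steps ?T T.edges m (rep x) (rep y)"
      using rep_lipschitz[OF steps_hops[OF xy]] by blast
    then show "hops ?T T.edges (rep x) (rep y) \<le> hops V E x y"
      using hops_le[OF m(2)] by linarith
    \<comment> \<open>The walk of length \<open>m\<close> guarantees that the minimum defining
      \<open>hops\<close> is attained.\<close>
    have "steps ?T T.edges (hops ?T T.edges (rep x) (rep y)) (rep x) (rep y)"
      using m(2) unfolding hops_def by (rule LeastI)
    then show "hops V E x y \<le> hops ?T T.edges (rep x) (rep y) + D"
      using rep_expanding xy by blast
  qed
  have "quasi_isometry V (graph_dist V E) ?T (graph_dist ?T T.edges) rep"
    unfolding quasi_isometry_def graph_dist_eq_hops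
  \<comment> \<open>The multiplicative constant is 1 and the additive one \<open>D\<close>. Every
    tree vertex is some \<open>rep x\<close>, so coarse surjectivity holds at distance 0.\<close>
  proof (rule conjI, simp, rule exI[of _ 1], rule exI[of _ "real D"], intro conjI ballI)
    fix x y assume "x \<in> V" "y \<in> V"
    then show "real (hops V E x y) / 1 - real D \<le> real (hops ?T T.edges (rep x) (rep y))"
      "real (hops ?T T.edges (rep x) (rep y)) \<le> 1 * real (hops V E x y) + real D"
      using low[of x y] up[of x y] by linarith+
  next
    fix z assume "z \<in> ?T"
    then show "\<exists>x\<in>V. real (hops ?T T.edges (rep x) z) \<le> real D"
      using hops_refl[of z ?T T.edges] by force
  qed auto
  then show ?thesis
    unfolding quasi_tree_def using simple connected T.tree by blast
qed

end


section \<open>The projection complex\<close>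

locale projection_complex = strong_projection_axioms +
  fixes K :: real
  assumes \<theta>_nonneg: "0 \<le> \<theta>" and K: "2 * \<theta> \<le> K"
begin

abbreviation B :: "'a \<Rightarrow> 'a \<Rightarrow> 'a set" where
  "B \<equiv> big_projections YY d K"

abbreviation E :: "'a set set" where
  "E \<equiv> projection_complex_edges YY d K"

lemma \<theta>_le_K: "ennreal \<theta> \<le> ennreal K"
  using \<theta>_nonneg K by (intro ennreal_leI) linarith

lemma B_iff: "Y \<in> B X Z \<longleftrightarrow> Y \<in> YY \<and> Y \<noteq> X \<and> Y \<noteq> Z \<and> ennreal K < d Y X Z"
  by (auto simp: big_projections_def)

lemma B_big: "Y \<in> B X Z \<Longrightarrow> ennreal \<theta> < d Y X Z"
  using \<theta>_le_K by (auto simp: B_iff)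

lemma B_sym: "\<lbrakk>X \<in> YY; Z \<in> YY\<rbrakk> \<Longrightarrow> B X Z = B Z X"
  using SP1 by (auto simp: B_iff)

lemma finite_B: "\<lbrakk>X \<in> YY; Z \<in> YY\<rbrakk> \<Longrightarrow> finite (B X Z)"
  by (rule finite_subset[OF _ SP5[of X Z]]) (use B_big in \<open>auto simp: B_iff\<close>)

lemma edge_iff: "{X, Z} \<in> E \<longleftrightarrow> X \<in> YY \<and> Z \<in> YY \<and> X \<noteq> Z \<and> B X Z = {}"
  unfolding projection_complex_edges_def by (auto simp: doubleton_eq_iff B_sym)

text \<open>For \<open>W \<in> B X Y\<close> the axiom \<open>SP3\<close> is applied twice: first \<open>W\<close> replaces \<open>X\<close> as seen from \<open>Y\<close>,
  and then \<open>Y\<close> replaces \<open>Z\<close> as seen from \<open>W\<close>.\<close>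

lemma B_mono:
  assumes "X \<in> YY" "Z \<in> YY" "Y \<in> B X Z"
  shows "B X Y \<subseteq> B X Z - {Y}"
proof
  fix W assume W: "W \<in> B X Y"
  have Y: "Y \<in> YY" "Y \<noteq> X" "Y \<noteq> Z"
    using assms by (auto simp: B_iff)
  have W': "W \<in> YY" "W \<noteq> X" "W \<noteq> Y"
    using W by (auto simp: B_iff)
  have eq: "d Y X U = d Y W U" if "U \<in> YY" "U \<noteq> Y" for U
    using SP3[of W Y X U] B_big[OF W] assms Y W' that by auto
  have big: "ennreal \<theta> < d Y W Z"
    using eq[of Z] B_big[OF assms(3)] assms Y by auto
  have "W \<noteq> Z"
    using big SP4[of Y Z] assms Y by auto
  moreover have "d Y Z W = d Y W Z"
    using SP1[of Y Z W] Y W' assms by auto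
  ultimately have "d W Z X = d W Y X"
    using SP3[of Y W Z X] big Y W' assms by auto
  then have "d W X Z = d W X Y"
    using SP1[of W X Z] SP1[of W X Y] Y W' assms \<open>W \<noteq> Z\<close> by auto
  with W \<open>W \<noteq> Z\<close> show "W \<in> B X Z - {Y}"
    by (auto simp: B_iff)
qed

text \<open>Splitting at any \<open>Y\<close> in \<open>B X Z\<close> leaves two pairs whose large
  projections lie in \<open>B X Z - {Y}\<close>, so induction on the finite cardinality
  applies.\<close>

lemma standard_path:
  "\<lbrakk>X \<in> YY; Z \<in> YY\<rbrakk> \<Longrightarrow> \<exists>n. steps (insert X (insert Z (B X Z))) E n X Z"
proof (induction "card (B X Z)" arbitrary: X Z rule: less_induct)
  case less
  show ?case
  proof (cases "B X Z = {}")
    case True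
    show ?thesis
    proof (cases "X = Z")
      case True
      then show ?thesis
        by (blast intro: steps_refl)
    next
      case False
      with True less.prems show ?thesis
        by (intro exI[of _ 1] steps_edge) (auto simp: edge_iff)
    qed
  next
    case False
    then obtain Y where Y: "Y \<in> B X Z"
      by blast
    then have YY: "Y \<in> YY"
      by (simp add: B_iff)
    have sub1: "B X Y \<subseteq> B X Z - {Y}"
      using B_mono less.prems Y by blast
    \<comment> \<open>This is \<open>B_mono\<close> with the endpoints exchanged, translated back by
      symmetry.\<close>
    have sub2: "B Y Z \<subseteq> B X Z - {Y}"
      using B_mono[of Z X Y] less.prems Y YY B_sym[of Z X] B_sym[of Y Z] by simp
    have "card (B X Y) < card (B X Z)" "card (B Y Z) < card (B X Z)"
      using sub1 sub2 Y finite_B[OF less.prems] by (auto intro!: psubset_card_mono)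
    then obtain m n where
      m: "steps (insert X (insert Y (B X Y))) E m X Y" and
      n: "steps (insert Y (insert Z (B Y Z))) E n Y Z"
      using less YY by meson
    have "steps (insert X (insert Z (B X Z))) E (m + n) X Z"
      by (rule steps_trans[OF steps_mono[OF m] steps_mono[OF n]]) (use sub1 sub2 Y in auto)
    then show ?thesis by blast
  qed
qed

lemma B_subset: "B X Z \<subseteq> YY"
  by (auto simp: B_iff)

sublocale PK: connected_simple_graph YY E
proof
  show "simple_graph YY E"
    unfolding simple_graph_def projection_complex_edges_def by blast
  show "connected_graph YY E"
    unfolding connected_graph_iff_steps
  proof (intro ballI)
    fix X Z assume XZ: "X \<in> YY" "Z \<in> YY"
    then obtain n where "steps (insert X (insert Z (B X Z))) E n X Z"
      using standard_path by blast
    then have "steps YY E n X Z"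
      by (rule steps_mono) (use XZ B_subset in auto)
    then show "\<exists>n. steps YY E n X Z" by blast
  qed
qed

section \<open>Projections along walks far from a vertex\<close>

abbreviation D :: "'a \<Rightarrow> 'a \<Rightarrow> nat" where
  "D \<equiv> hops YY E"

lemma D_adjacent: "{X, Z} \<in> E \<Longrightarrow> D X Z \<le> 1"
  by (intro hops_edge) (auto simp: edge_iff)

text \<open>The standard path enters \<open>Y\<close> from \<open>X\<close> or from an element of
  \<open>B X Y\<close>. If all those elements were adjacent to \<open>X\<close>, then
  \<open>Y\<close> would be within distance 2.\<close>

lemma far_nonadjacent:
  assumes "X \<in> YY" "Y \<in> YY" "3 \<le> D X Y"
  shows "\<exists>V\<in>B X Y. {X, V} \<notin> E"
proof (rule ccontr)
  assume adj: "\<not> ?thesis"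
  obtain n where n: "steps (insert X (insert Y (B X Y))) E n X Y"
    using standard_path assms by blast
  have "X \<noteq> Y"
    using assms hops_refl by fastforce
  have "(\<exists>z\<in>insert X (insert Y (B X Y)). z \<noteq> Y \<and> z = Y) \<or>
    (\<exists>u\<in>insert X (insert Y (B X Y)). \<exists>v\<in>insert X (insert Y (B X Y)). {u, v} \<in> E \<and> u \<noteq> Y \<and> v = Y)"
    by (rule steps_crossing[OF n]) (use \<open>X \<noteq> Y\<close> in auto)
  then obtain U where U: "U \<in> insert X (B X Y)" "{U, Y} \<in> E"
    by auto
  then have "U \<in> YY"
    using assms by (auto simp: B_iff)
  have "D X U \<le> 1"
    using U adj D_adjacent hops_refl assms by fastforce
  moreover have "D U Y \<le> 1"
    using U D_adjacent by blast
  moreover have "D X Y \<le> D X U + D U Y"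
    using PK.hops_triangle assms \<open>U \<in> YY\<close> by blast
  ultimately show False
    using assms by linarith
qed

text \<open>For \<open>V \<in> B X Y\<close> not adjacent to \<open>X\<close>, both \<open>d V X Y\<close> and \<open>d V X' Y\<close> exceed \<open>\<theta>\<close>, so \<open>SP3\<close>
  identifies the projections of \<open>X\<close> and \<open>X'\<close> to \<open>Y\<close> with that of \<open>V\<close>. If \<open>d V X' Y\<close> were small,
  an element \<open>U \<noteq> X'\<close> of \<open>B X V\<close> would lie in \<open>B X X'\<close>, against adjacency.\<close>

lemma adjacent_same_projection:
  assumes e: "{X, X'} \<in> E" and Y: "Y \<in> YY" and far: "3 \<le> D X Y"
    and W: "W \<in> YY" "W \<noteq> Y"
  shows "d Y X W = d Y X' W"
proof -
  have X: "X \<in> YY" "X' \<in> YY" "X \<noteq> X'" and no_big: "B X X' = {}"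
    using e by (auto simp: edge_iff)
  have "X \<noteq> Y" "X' \<noteq> Y"
    using far D_adjacent[OF e] X hops_refl[of X YY E] by auto
  obtain V where V: "V \<in> B X Y" "{X, V} \<notin> E"
    using far_nonadjacent X Y far by blast
  then have V': "V \<in> YY" "V \<noteq> X" "V \<noteq> Y" "V \<noteq> X'"
    using e by (auto simp: B_iff)
  obtain U where U: "U \<in> B X V"
    using V V' X by (auto simp: edge_iff)
  then have U': "U \<in> YY" "U \<noteq> X" "U \<noteq> V"
    by (auto simp: B_iff)
  have XU: "d V X T = d V U T" if "T \<in> YY" "T \<noteq> V" for T
    using SP3[of U V X T] B_big[OF U] U' V' X that by auto
  have big: "ennreal \<theta> < d V X' Y"
  proof (cases "U = X'")
    case True
    then show ?thesis
      using XU[of Y] B_big[OF V(1)] V' Y by auto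
  next
    case False
    have "d V X X' \<le> ennreal \<theta>"
    proof (rule ccontr)
      assume "\<not> ?thesis"
      then have "ennreal \<theta> < d V X' U"
        using XU[of X'] SP1[of V U X'] X V' U' by auto
      then have "d U X' X = d U V X"
        using SP3[of V U X' X] X V' U' False by auto
      then have "d U X X' = d U X V"
        using SP1[of U X X'] SP1[of U X V] X V' U' False by auto
      then have "U \<in> B X X'"
        using U False by (auto simp: B_iff)
      with no_big show False by simp
    qed
    show ?thesis
    proof (rule ccontr)
      assume "\<not> ?thesis"
      \<comment> \<open>Two distances of at most \<theta> add up to at most \<open>K\<close>,
        against \<open>V\<close> being in \<open>B X Y\<close>.\<close>
      then have "d V X X' + d V X' Y \<le> ennreal \<theta> + ennreal \<theta>"
        using \<open>d V X X' \<le> ennreal \<theta>\<close> by (intro add_mono) auto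
      also have "\<dots> \<le> ennreal K"
        using \<theta>_nonneg K by (simp flip: ennreal_plus add: ennreal_leI)
      finally have "d V X X' + d V X' Y \<le> ennreal K" .
      moreover have "d V X Y \<le> d V X X' + d V X' Y"
        using SP2[of V X X' Y] X V' Y by auto
      ultimately show False
        using V by (auto simp: B_iff)
    qed
  qed
  have "d Y X W = d Y V W"
    using SP3[of V Y X W] B_big[OF V(1)] X V' Y W \<open>X \<noteq> Y\<close> by auto
  moreover have "d Y X' W = d Y V W"
    using SP3[of V Y X' W] big X V' Y W \<open>X' \<noteq> Y\<close> by auto
  ultimately show ?thesis by simp
qed

text \<open>On a walk staying at distance at least 3 from \<open>Y\<close> the projection to
  \<open>Y\<close> never changes, so \<open>d Y X Z\<close> would equal \<open>d Y Z Z\<close>,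
  which is at most \<theta>.\<close>

lemma walk_passes_near:
  assumes "steps S E n X Z" "S \<subseteq> YY" "Y \<in> B X Z"
  shows "\<exists>V\<in>S. D V Y \<le> 2"
proof (rule ccontr)
  assume "\<not> ?thesis"
  then have far: "3 \<le> D V Y" if "V \<in> S" for V
    using that by fastforce
  have Y: "Y \<in> YY" "Y \<noteq> Z"
    using assms by (auto simp: B_iff)
  have Z: "Z \<in> YY"
    using assms(2) steps_in[OF assms(1)] by blast
  have "d Y X Z = d Y Z Z"
    using assms(1) Z Y
  proof (induction rule: steps.induct)
    case (steps_Suc x y m z)
    then show ?case
      using adjacent_same_projection[of x y Y z] far by auto
  qed auto
  then show False
    using B_big[OF assms(3)] SP4[of Y Z] Y Z by auto
qed

text \<open>Each \<open>Y\<close> in \<open>B X Z\<close> is near both the outer walk and the path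
  through \<open>R\<close>. Comparing distances to \<open>R\<close> puts the whole standard path
  within 6 of \<open>X\<close> or \<open>Z\<close>.\<close>

lemma ball_bottleneck:
  assumes R: "R \<in> YY" and X: "X \<in> YY" and Z: "Z \<in> YY" and eq: "D R X = D R Z"
    and out: "steps {V \<in> YY. D R X \<le> D R V} E n X Z"
  shows "D X Z \<le> 13"
proof -
  have near: "D X Y \<le> 6 \<or> D Z Y \<le> 6" if "Y \<in> insert X (insert Z (B X Z))" for Y
  proof (cases "Y \<in> B X Z")
    case False
    then show ?thesis
      using that X Z hops_refl by fastforce
  next
    case True
    then have Y: "Y \<in> YY"
      by (simp add: B_iff)
    \<comment> \<open>The walk outside the ball shows that \<open>Y\<close> is far from \<open>R\<close>, and the geodesics through \<open>R\<close> then
      place \<open>Y\<close> near one of their endpoints.\<close>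
    obtain V where V: "V \<in> YY" "D R X \<le> D R V" "D V Y \<le> 2"
      using walk_passes_near[OF out _ True] by auto
    let ?G = "\<lambda>X. {P \<in> YY. D X P + D P R = D X R}"
    have "steps (?G X \<union> ?G Z) E (D X R + D Z R) X Z"
      by (rule steps_trans[OF steps_mono[OF PK.geodesic[OF X R]]
            steps_mono[OF steps_sym[OF PK.geodesic[OF Z R]]]]) auto
    then obtain P where P: "P \<in> ?G X \<union> ?G Z" "D P Y \<le> 2"
      using walk_passes_near[OF _ _ True] by blast
    then have PY: "P \<in> YY" by auto
    have "D R V \<le> D R P + D P V" "D P V \<le> D P Y + D Y V"
      using R V Y PY by (auto intro: PK.hops_triangle)
    \<comment> \<open>The 4 is 2 from \<open>P\<close> to \<open>Y\<close> plus 2 from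
      \<open>Y\<close> to \<open>V\<close>. Hence \<open>P\<close> is within 4 of the end of its
      geodesic other than \<open>R\<close>, and \<open>Y\<close> within 6.\<close>
    then have far: "D R X \<le> D P R + 4"
      using V P hops_sym[of YY E Y V] hops_sym[of YY E P R] by linarith
    have "D X Y \<le> D X P + D P Y" "D Z Y \<le> D Z P + D P Y"
      using X Z Y PY by (auto intro: PK.hops_triangle)
    moreover have "D X P + D P R = D R X \<or> D Z P + D P R = D R X"
      using P eq hops_sym[of YY E R] by auto
    ultimately show ?thesis
      using far P(2) by linarith
  qed
  \<comment> \<open>The standard path must step from the ball around \<open>X\<close> into the ball around \<open>Z\<close>.\<close>
  obtain m where m: "steps (insert X (insert Z (B X Z))) E m X Z"
    using standard_path X Z by blast
  have "(\<exists>Y\<in>insert X (insert Z (B X Z)). D X Y \<le> 6 \<and> D Z Y \<le> 6) \<or>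
    (\<exists>U\<in>insert X (insert Z (B X Z)). \<exists>V\<in>insert X (insert Z (B X Z)).
      {U, V} \<in> E \<and> D X U \<le> 6 \<and> D Z V \<le> 6)"
    by (rule steps_crossing[OF m]) (use near X Z in \<open>auto simp: hops_refl\<close>)
  then obtain U V where UV: "U \<in> YY" "V \<in> YY" "D U V \<le> 1" "D X U \<le> 6" "D Z V \<le> 6"
    using X Z B_subset hops_refl D_adjacent
    by (metis insertE le0 subsetD)
  \<comment> \<open>Radius 6 on either side and one crossing step give 13.\<close>
  have "D X Z \<le> D X U + D U Z" "D U Z \<le> D U V + D V Z"
    using X Z UV by (auto intro: PK.hops_triangle)
  then show ?thesis
    using UV hops_sym[of YY E Z V] by linarith
qed

lemma projection_complex_quasi_tree: "quasi_tree YY E"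
proof (cases "YY = {}")
  case True
  have "tree_graph {} {}"
    by (simp add: tree_graph_def simple_graph_def connected_graph_def cycle_def walk_def)
  moreover have "quasi_isometry YY (graph_dist YY E) {} (graph_dist {} {}) id"
    unfolding quasi_isometry_def using True by (auto intro: exI[of _ 1])
  ultimately show ?thesis
    unfolding quasi_tree_def using PK.simple PK.connected by blast
next
  case False
  then obtain R where "R \<in> YY" by blast
  then interpret bottleneck_graph YY E R 13
    by unfold_locales (auto intro: ball_bottleneck)
  show ?thesis
    by (rule quasi_tree)
qed

end

theorem theorem3p5:
  fixes YY :: "'a set" and d :: "'a \<Rightarrow> 'a \<Rightarrow> 'a \<Rightarrow> ennreal" and \<theta> K :: real
  assumes "strong_projection_axioms YY d \<theta>"
    and "0 \<le> \<theta>"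
    and "3 * \<theta> \<le> K"
  shows "quasi_tree YY (projection_complex_edges YY d K)"
proof -
  interpret projection_complex YY d \<theta> K
    using assms by (simp add: projection_complex_def projection_complex_axioms_def)
  show ?thesis
    by (rule projection_complex_quasi_tree)
qed

end
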